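(* For each integer $n\ge 1$, $$L_n(x)=2\,T_{2^{n-1}}\!\left(\frac{x^2}{2}-1\right).$$
   Context: The Lucas-Lehmer polynomials $L_n$ are defined by $L_0(x)=x$ and $L_n(x)=L_{n-1}(x)^2-2$ for $n\ge 1$. The Chebyshev polynomials of the first kind $T_n$ are defined by $T_0(x)=1$, $T_1(x)=x$, and $T_n(x)=2xT_{n-1}(x)-T_{n-2}(x)$ for $n\ge 2$. *)

theory Defs
  imports Complex_Main "HOL-Computational_Algebra.Polynomial"
begin

fun lucas_lehmer_poly :: "nat \<Rightarrow> 'a :: comm_ring_1 poly" where
  "lucas_lehmer_poly 0 = [:0, 1:]"
| "lucas_lehmer_poly (Suc n) = (lucas_lehmer_poly n)\<^sup>2 - 2"

fun chebyshev_poly :: "nat \<Rightarrow> 'a :: comm_ring_1 poly" where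
  "chebyshev_poly 0 = 1"
| "chebyshev_poly (Suc 0) = [:0, 1:]"
| "chebyshev_poly (Suc (Suc n)) = 2 * [:0, 1:] * chebyshev_poly (Suc n) - chebyshev_poly n"

end

theory Submission
  imports Defs
begin

text \<open>
  If \<open>y = 2 cos \<theta>\<close>, then \<open>y\<^sup>2 - 2 = 2 cos 2\<theta>\<close>, so each step of the Lucas-Lehmer recurrence
  doubles an angle. Since \<open>T\<^sub>m(cos \<theta>) = cos m\<theta>\<close>, doubling the index of a Chebyshev polynomial
  does the same. Algebraically, the doubling is the identity
  \<open>T\<^bsub>2m\<^esub> = 2 T\<^sub>m\<^sup>2 - 1\<close>: it says that \<open>2 T\<^bsub>2m\<^esub>\<close> is obtained from \<open>2 T\<^sub>m\<close> by squaring and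
  subtracting \<open>2\<close>. Substitution of \<open>x\<^sup>2 / 2 - 1\<close> is a ring homomorphism and preserves this. Both
  sides of the theorem therefore satisfy the same recurrence, and they agree at \<open>n = 1\<close>, where
  both are \<open>x\<^sup>2 - 2\<close>.
\<close>

text \<open>
  The counterpart of \<open>2 cos a cos b = cos (a + b) + cos (a - b)\<close>. The offset \<open>d\<close> is what makes
  the doubling identity inductive: lowering one index of a product while keeping the other changes
  their difference.
\<close>

lemma chebyshev_poly_product_to_sum:
  "2 * chebyshev_poly m * chebyshev_poly (m + d) =
    (chebyshev_poly (2 * m + d) + chebyshev_poly d :: 'a :: comm_ring_1 poly)"
proof (induction m arbitrary: d rule: chebyshev_poly.induct)
  case 1
  show ?case by simp
next
  case 2
  show ?case by simp
next
  case (3 m)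
  let ?T = "chebyshev_poly :: nat \<Rightarrow> 'a poly"
  let ?x = "[:0, 1:] :: 'a poly"
  have recurrence: "?T (Suc (Suc k)) = 2 * ?x * ?T (Suc k) - ?T k" for k
    by (rule chebyshev_poly.simps(3))
  have "2 * ?T (Suc (Suc m)) * ?T (Suc (Suc m) + d) =
      2 * ?x * (2 * ?T (Suc m) * ?T (Suc m + Suc d)) - 2 * ?T m * ?T (m + Suc (Suc d))"
    unfolding recurrence[of m] by (simp only: add_Suc add_Suc_right) (simp only: algebra_simps)
  also have "\<dots> = 2 * ?x * (?T (2 * Suc m + Suc d) + ?T (Suc d))
      - (?T (2 * m + Suc (Suc d)) + ?T (Suc (Suc d)))"
    by (simp only: "3.IH")
  also have "\<dots> = (2 * ?x * ?T (Suc (2 * m + Suc (Suc d))) - ?T (2 * m + Suc (Suc d)))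
      + (2 * ?x * ?T (Suc d) - ?T (Suc (Suc d)))"
    by (simp only: mult_Suc_right add_Suc add_Suc_right add_2_eq_Suc) (simp only: algebra_simps)
  also have "\<dots> = ?T (2 * Suc (Suc m) + d) + ?T d"
    using recurrence[of d] recurrence[of "2 * m + Suc (Suc d)"] by (simp del: chebyshev_poly.simps)
  finally show ?case .
qed

lemma chebyshev_poly_double:
  "chebyshev_poly (2 * m) = (2 * (chebyshev_poly m)\<^sup>2 - 1 :: 'a :: comm_ring_1 poly)"
  using chebyshev_poly_product_to_sum[of m 0, where ?'a = 'a]
  by (simp add: power2_eq_square mult.assoc)

theorem proposition8:
  fixes n :: nat
  assumes "n \<ge> 1"
  shows "(lucas_lehmer_poly n :: 'a :: field_char_0 poly) =
    2 * pcompose (chebyshev_poly (2 ^ (n - 1))) [:-1, 0, 1/2:]"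
  using assms
proof (induction n rule: dec_induct)
  case base
  show ?case
    by (simp add: power2_eq_square numeral_poly pcompose_pCons)
next
  case (step n)
  let ?q = "[:-1, 0, 1/2:] :: 'a poly"
  let ?T = "chebyshev_poly (2 ^ (n - 1)) :: 'a poly"
  have "2 ^ n = 2 * (2 ^ (n - 1) :: nat)"
    using step.hyps by (cases n) auto
  then have "chebyshev_poly (2 ^ n) = 2 * ?T\<^sup>2 - 1"
    by (simp only: chebyshev_poly_double)
  then have doubled: "pcompose (chebyshev_poly (2 ^ n)) ?q = 2 * (pcompose ?T ?q)\<^sup>2 - 1"
    by (simp add: pcompose_diff pcompose_mult power2_eq_square numeral_poly pcompose_1
        pcompose_smult)
  show ?case
    by (simp add: step.IH doubled power_mult_distrib right_diff_distrib)
qed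

end
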